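(* There exists $n_0$ such that for every even integer $n\geq n_0$, there is a $(2,5)$ knight's tour in $[n]^2$.
   Context: $[n]=\{0,\dots,n-1\}$. The $(2,5)$ knight's graph on $[n]^2$ has vertex set $[n]^2$, with $(x,y)\sim(x',y')$ iff $\{|x-x'|,|y-y'|\}=\{2,5\}$; a $(2,5)$ knight's tour is a Hamiltonian cycle of it. *)

theory Defs
  imports "Graph_Theory.Pair_Digraph"
begin

text \<open>
  An undirected simple graph is a \<^locale>\<open>pair_graph\<close>: a finite loop-free digraph whose set of
  arcs is symmetric. Coordinates are integers so that the differences below do not truncate.
\<close>

definition board :: "nat \<Rightarrow> (int \<times> int) set" where
  "board n = {0..<int n} \<times> {0..<int n}"

definition knights_graph :: "int \<Rightarrow> int \<Rightarrow> nat \<Rightarrow> (int \<times> int) pair_pre_digraph" where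
  "knights_graph a b n =
     \<lparr> pverts = board n,
       parcs = {((x, y), (x', y')) | x y x' y'.
                  (x, y) \<in> board n \<and> (x', y') \<in> board n \<and>
                  {\<bar>x - x'\<bar>, \<bar>y - y'\<bar>} = {a, b}} \<rparr>"

lemma pair_graph_knights_graph:
  assumes "a \<noteq> 0 \<or> b \<noteq> 0"
  shows "pair_graph (knights_graph a b n)"
proof
  have "parcs (knights_graph a b n) \<subseteq> board n \<times> board n"
    by (auto simp: knights_graph_def)
  then show "finite (parcs (knights_graph a b n))"
    by (rule finite_subset) (simp add: board_def)
next
  show "symmetric (with_proj (knights_graph a b n))"
    unfolding symmetric_def with_proj_simps
    by (rule symI) (auto simp: knights_graph_def abs_minus_commute)
qed (use assms in \<open>auto simp: knights_graph_def board_def\<close>)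

text \<open>
  In \<^const>\<open>pre_digraph.cycle\<close> a single edge traversed back and forth counts as a cycle of
  length 2; the bound on the length excludes this, as usual for cycles in simple graphs.
\<close>

definition hamiltonian_cycle :: "'a pair_pre_digraph \<Rightarrow> ('a \<times> 'a) awalk \<Rightarrow> bool" where
  "hamiltonian_cycle G p \<longleftrightarrow>
     pre_digraph.cycle (with_proj G) p \<and> 3 \<le> length p \<and> fst ` set p = pverts G"

definition knights_tour :: "int \<Rightarrow> int \<Rightarrow> nat \<Rightarrow> ((int \<times> int) \<times> (int \<times> int)) awalk \<Rightarrow> bool" where
  "knights_tour a b n p \<longleftrightarrow> hamiltonian_cycle (knights_graph a b n) p"

end

theory Submission
  imports Defs
begin

text \<open>
  Two disjoint cycles, one through an edge \<open>ab\<close> and the other through an edge \<open>cd\<close>, merge into one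
  cycle when \<open>a\<close> is adjacent to \<open>c\<close> and \<open>b\<close> to \<open>d\<close>: replace \<open>ab\<close> and \<open>cd\<close> by \<open>ac\<close> and \<open>bd\<close>.
  Call a \<open>w \<times> h\<close> board linkable if it has a tour through the edges \<open>(0,0)(2,5)\<close> and
  \<open>(w-5,2)(w-3,7)\<close> and through their counterparts under the exchange of the coordinates. When two
  linkable boards of the same height are put side by side, the second of these edges in the left
  board and the first one in the right board differ by the leap \<open>(5,-2)\<close>, so the tours merge, and
  the combined board is again linkable. Since linkability is symmetric in \<open>w\<close> and \<open>h\<close>, it suffices
  to give linkable tours of the boards \<open>14 \<times> 14\<close>, \<open>14 \<times> 18\<close> and \<open>18 \<times> 18\<close>: every large even number
  has the form \<open>14 i + 18 j\<close>.
\<close>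

section \<open>Cycles as lists of vertices\<close>

fun path_edges :: "'a list \<Rightarrow> 'a set set" where
  "path_edges (x # y # zs) = insert {x, y} (path_edges (y # zs))"
| "path_edges _ = {}"

definition cycle_edges :: "'a list \<Rightarrow> 'a set set" where
  "cycle_edges xs = path_edges (xs @ [hd xs])"

text \<open>Edges are unordered, so the last condition asks for \<open>E\<close> in both directions
  along the cycle; reversing the list keeps it.\<close>

definition cycle_on :: "('a \<Rightarrow> 'a \<Rightarrow> bool) \<Rightarrow> 'a set \<Rightarrow> 'a list \<Rightarrow> bool" where
  "cycle_on E V xs \<longleftrightarrow>
     distinct xs \<and> set xs = V \<and> 3 \<le> length xs \<and> (\<forall>u v. {u, v} \<in> cycle_edges xs \<longrightarrow> E u v)"

section \<open>Edge sets under concatenation, reversal and mapping\<close>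

lemma path_edges_append:
  "xs \<noteq> [] \<Longrightarrow> ys \<noteq> [] \<Longrightarrow>
     path_edges (xs @ ys) = insert {last xs, hd ys} (path_edges xs \<union> path_edges ys)"
proof (induction xs rule: path_edges.induct)
  case ("2_2" x)
  then show ?case by (cases ys) auto
qed auto

lemma cycle_edges_eq:
  "xs \<noteq> [] \<Longrightarrow> cycle_edges xs = insert {last xs, hd xs} (path_edges xs)"
  by (simp add: cycle_edges_def path_edges_append)

lemma path_edges_rev: "path_edges (rev xs) = path_edges xs"
proof (induction xs rule: path_edges.induct)
  case (1 x y zs)
  have "path_edges (rev (x # y # zs)) = insert {last (rev (y # zs)), x} (path_edges (rev (y # zs)))"
    using path_edges_append[of "rev (y # zs)" "[x]"] by simp
  with 1 show ?case by (simp add: insert_commute)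
qed auto

lemma cycle_edges_rev: "xs \<noteq> [] \<Longrightarrow> cycle_edges (rev xs) = cycle_edges xs"
  by (simp add: cycle_edges_eq path_edges_rev hd_rev last_rev insert_commute)

lemma path_edges_map: "path_edges (map f xs) = image f ` path_edges xs"
  by (induction xs rule: path_edges.induct) auto

lemma cycle_edges_map: "xs \<noteq> [] \<Longrightarrow> cycle_edges (map f xs) = image f ` cycle_edges xs"
  by (simp add: cycle_edges_eq path_edges_map hd_map last_map)

lemma zip_tl_path_edges: "(u, v) \<in> set (zip xs (tl xs)) \<Longrightarrow> {u, v} \<in> path_edges xs"
  by (induction xs rule: path_edges.induct) auto

section \<open>Opening, merging and transporting cycles\<close>

lemma path_edges_split:
  assumes "e \<in> path_edges xs"
  obtains us vs where "xs = us @ vs" "us \<noteq> []" "vs \<noteq> []" "e = {last us, hd vs}"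
  using assms
proof (induction xs arbitrary: thesis rule: path_edges.induct)
  case (1 x y zs)
  show ?case
  proof (cases "e = {x, y}")
    case True
    then show ?thesis by (intro "1.prems"(1)[of "[x]" "y # zs"]) auto
  next
    case False
    with "1.prems"(2) have "e \<in> path_edges (y # zs)" by simp
    then obtain us vs where "y # zs = us @ vs" "us \<noteq> []" "vs \<noteq> []" "e = {last us, hd vs}"
      using "1.IH" by blast
    then show ?thesis by (intro "1.prems"(1)[of "x # us" vs]) auto
  qed
qed auto

text \<open>Rotate the list until the given edge is the closing one, then reverse it if the ends
  come in the wrong order. Equality of multisets carries distinctness, vertex set and length along
  at once.\<close>

lemma cycle_open_at_edge:
  assumes "xs \<noteq> []" and "{a, b} \<in> cycle_edges xs"
  obtains ys where "mset ys = mset xs" "hd ys = a" "last ys = b" "cycle_edges ys = cycle_edges xs"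
proof -
  have "\<exists>ys. mset ys = mset xs \<and> {last ys, hd ys} = {a, b} \<and> cycle_edges ys = cycle_edges xs"
  proof (cases "{a, b} = {last xs, hd xs}")
    case False
    with assms have "{a, b} \<in> path_edges xs" by (simp add: cycle_edges_eq)
    then obtain us vs where "xs = us @ vs" "us \<noteq> []" "vs \<noteq> []" "{a, b} = {last us, hd vs}"
      by (rule path_edges_split)
    \<comment> \<open>Swapping the two halves makes the cut edge the closing edge, while the old
      closing edge becomes the joint between them.\<close>
    then show ?thesis
      by (intro exI[of _ "vs @ us"]) (auto simp: cycle_edges_eq path_edges_append)
  qed auto
  then obtain ys where ys: "mset ys = mset xs" "{last ys, hd ys} = {a, b}"
    "cycle_edges ys = cycle_edges xs"
    by blast
  have "ys \<noteq> []" using ys(1) assms(1) by auto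
  show thesis
  proof (cases "hd ys = a")
    case True
    with ys(2) have "last ys = b" by (auto simp: doubleton_eq_iff)
    with True ys show thesis using that by blast
  next
    case False
    with ys(2) have "last ys = a" "hd ys = b" by (auto simp: doubleton_eq_iff)
    with ys \<open>ys \<noteq> []\<close> show thesis
      by (intro that[of "rev ys"]) (auto simp: cycle_edges_rev hd_rev last_rev)
  qed
qed

text \<open>Opened as a path from \<open>a\<close> to \<open>b\<close> and a path from
  \<open>d\<close> to \<open>c\<close>, the cycles concatenate with joint \<open>bd\<close> and
  closing edge \<open>ca\<close>. The second conclusion lets prescribed edges survive, so that
  merging can be repeated.\<close>

lemma merge_cycles:
  assumes xs: "cycle_on E V xs" and ys: "cycle_on E W ys" and disj: "V \<inter> W = {}"
    and ab: "{a, b} \<in> cycle_edges xs" and cd: "{c, d} \<in> cycle_edges ys"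
    and E: "E a c" "E c a" "E b d" "E d b"
  obtains zs where "cycle_on E (V \<union> W) zs"
    "(cycle_edges xs - {{a, b}}) \<union> (cycle_edges ys - {{c, d}}) \<subseteq> cycle_edges zs"
proof -
  have "xs \<noteq> []" "ys \<noteq> []" using xs ys by (auto simp: cycle_on_def)
  obtain us where us: "mset us = mset xs" "hd us = a" "last us = b"
    "cycle_edges us = cycle_edges xs"
    using cycle_open_at_edge[OF \<open>xs \<noteq> []\<close> ab] .
  from cd have "{d, c} \<in> cycle_edges ys" by (simp add: insert_commute)
  then obtain vs where vs: "mset vs = mset ys" "hd vs = d" "last vs = c"
    "cycle_edges vs = cycle_edges ys"
    using cycle_open_at_edge[OF \<open>ys \<noteq> []\<close>] by metis
  have "us \<noteq> []" "vs \<noteq> []" using us(1) vs(1) \<open>xs \<noteq> []\<close> \<open>ys \<noteq> []\<close> by auto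
  have sets: "set us = V" "set vs = W" and "distinct us" "distinct vs" "3 \<le> length us"
    using us(1) vs(1) xs ys
    by (auto simp: cycle_on_def dest: mset_eq_setD mset_eq_imp_distinct_iff mset_eq_length)
  have edges: "cycle_edges xs = insert {b, a} (path_edges us)"
    "cycle_edges ys = insert {c, d} (path_edges vs)"
    using us vs \<open>us \<noteq> []\<close> \<open>vs \<noteq> []\<close> cycle_edges_eq by metis+
  have zs: "cycle_edges (us @ vs) = {{c, a}, {b, d}} \<union> path_edges us \<union> path_edges vs"
    using us(2,3) vs(2,3) \<open>us \<noteq> []\<close> \<open>vs \<noteq> []\<close> by (auto simp: cycle_edges_eq path_edges_append)
  have "E u v" if "{u, v} \<in> cycle_edges (us @ vs)" for u v
  proof -
    from that consider "{u, v} = {c, a}" | "{u, v} = {b, d}"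
      | "{u, v} \<in> cycle_edges xs" | "{u, v} \<in> cycle_edges ys"
      unfolding zs edges by blast
    then show ?thesis
      using E xs ys by cases (auto simp: doubleton_eq_iff cycle_on_def)
  qed
  then have "cycle_on E (V \<union> W) (us @ vs)"
    using sets disj \<open>distinct us\<close> \<open>distinct vs\<close> \<open>3 \<le> length us\<close> by (auto simp: cycle_on_def)
  then show thesis
    by (rule that) (auto simp: zs edges insert_commute)
qed

lemma cycle_on_map:
  assumes "cycle_on E V xs" and "inj f" and "\<And>u v. E u v \<Longrightarrow> E (f u) (f v)"
  shows "cycle_on E (f ` V) (map f xs)"
proof -
  have "xs \<noteq> []" using assms(1) by (auto simp: cycle_on_def)
  have "E u v" if uv: "{u, v} \<in> cycle_edges (map f xs)" for u v
  proof -
    from uv obtain e where e: "e \<in> cycle_edges xs" "{u, v} = f ` e"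
      using \<open>xs \<noteq> []\<close> by (auto simp: cycle_edges_map)
    then obtain p q where "u = f p" "v = f q" "p \<in> e" "q \<in> e" by blast
    \<comment> \<open>Both sets have the same image under \<open>f\<close>, which is
      injective.\<close>
    with e \<open>inj f\<close> have "e = {p, q}" by (metis image_insert image_empty inj_image_eq_iff)
    with e \<open>u = f p\<close> \<open>v = f q\<close> show ?thesis using assms by (auto simp: cycle_on_def)
  qed
  then show ?thesis
    using assms by (auto simp: cycle_on_def distinct_map intro: inj_on_subset)
qed

section \<open>From vertex lists to closed walks given by arcs\<close>

lemma pcas_zip_tl: "zs \<noteq> [] \<Longrightarrow> pcas (hd zs) (zip zs (tl zs)) (last zs)"
  by (induction zs rule: path_edges.induct) auto

lemma pawalk_verts_zip_tl: "zs \<noteq> [] \<Longrightarrow> pawalk_verts (hd zs) (zip zs (tl zs)) = zs"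
  by (induction zs rule: path_edges.induct) auto

lemma hamiltonian_cycle_of_cycle_on:
  assumes "cycle_on (\<lambda>u v. (u, v) \<in> parcs G) (pverts G) xs"
  shows "\<exists>p. hamiltonian_cycle G p"
proof -
  define zs where "zs = xs @ [hd xs]"
  define p where "p = zip zs (tl zs)"
  have xs: "distinct xs" "set xs = pverts G" "3 \<le> length xs"
    using assms by (auto simp: cycle_on_def)
  then have "xs \<noteq> []" by auto
  \<comment> \<open>The last entry of \<open>zs\<close> starts no arc. Hence the tails of the arcs
    are exactly \<open>xs\<close>, which yields both the vertex set and the length.\<close>
  have p_zip: "p = zip xs (tl xs @ [hd xs])"
    using \<open>xs \<noteq> []\<close> zip_append[of xs "tl xs @ [hd xs]" "[hd xs]" "[]"] by (simp add: p_def zs_def)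
  have "set p \<subseteq> parcs G"
    using assms zip_tl_path_edges[of _ _ zs]
    by (auto simp: cycle_on_def p_def zs_def cycle_edges_def)
  moreover have "pcas (hd xs) p (hd xs)"
    using pcas_zip_tl[of zs] \<open>xs \<noteq> []\<close> by (simp add: zs_def p_def)
  moreover have "hd xs \<in> pverts G" using hd_in_set[OF \<open>xs \<noteq> []\<close>] xs(2) by simp
  ultimately have walk: "pre_digraph.awalk (with_proj G) (hd xs) p (hd xs)"
    unfolding pre_digraph.awalk_def cas_with_proj_eq with_proj_simps by blast
  \<comment> \<open>Only the repeated start is dropped; what remains is \<open>xs\<close> rotated by
    one place.\<close>
  have "distinct (tl (pawalk_verts (hd xs) p))"
    using pawalk_verts_zip_tl[of zs] \<open>xs \<noteq> []\<close> xs(1)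
    by (cases xs) (auto simp: zs_def p_def)
  moreover have "map fst p = xs" using \<open>xs \<noteq> []\<close> by (simp add: p_zip)
  then have "fst ` set p = pverts G" "length p = length xs"
    using xs(2) by (metis set_map, metis length_map)
  moreover have "3 \<le> length p" "p \<noteq> []" using \<open>length p = length xs\<close> xs(3) by auto
  ultimately show ?thesis
    using walk unfolding hamiltonian_cycle_def pre_digraph.cycle_def awalk_verts_with_proj_eq
    by blast
qed

section \<open>Linking boards\<close>

fun leap :: "int \<times> int \<Rightarrow> int \<times> int \<Rightarrow> bool" where
  "leap (x, y) (x', y') \<longleftrightarrow>
     \<bar>x - x'\<bar> = 2 \<and> \<bar>y - y'\<bar> = 5 \<or> \<bar>x - x'\<bar> = 5 \<and> \<bar>y - y'\<bar> = 2"

lemma leap_commute: "leap u v \<longleftrightarrow> leap v u"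
  by (cases u; cases v) (simp add: abs_minus_commute)

definition rect :: "int \<Rightarrow> int \<Rightarrow> (int \<times> int) set" where
  "rect w h = {0..<w} \<times> {0..<h}"

text \<open>The two edges at \<open>(0, 0)\<close> lie in every tour, since a leap from this corner
  reaches no other square of the board; the other two are real demands on the tour.\<close>

definition link_edges :: "int \<Rightarrow> int \<Rightarrow> (int \<times> int) set set" where
  "link_edges w h =
     {{(0, 0), (2, 5)}, {(w - 5, 2), (w - 3, 7)}, {(0, 0), (5, 2)}, {(2, h - 5), (7, h - 3)}}"

definition linkable :: "int \<Rightarrow> int \<Rightarrow> bool" where
  "linkable w h \<longleftrightarrow> (\<exists>xs. cycle_on leap (rect w h) xs \<and> link_edges w h \<subseteq> cycle_edges xs)"

text \<open>Exchanging the coordinates preserves \<open>leap\<close> and interchanges the two pairs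
  of link edges, so stacking boards vertically needs no merge of its own.\<close>

lemma linkable_commute:
  assumes "linkable w h"
  shows "linkable h w"
proof -
  obtain xs where xs: "cycle_on leap (rect w h) xs" "link_edges w h \<subseteq> cycle_edges xs"
    using assms by (auto simp: linkable_def)
  then have "xs \<noteq> []" by (auto simp: cycle_on_def)
  have "cycle_on leap (prod.swap ` rect w h) (map prod.swap xs)"
    using xs(1) by (rule cycle_on_map) auto
  moreover have "prod.swap ` rect w h = rect h w"
    by (simp add: rect_def product_swap)
  moreover have "link_edges h w = image prod.swap ` link_edges w h"
    by (auto simp: link_edges_def)
  ultimately show ?thesis
    using xs(2) \<open>xs \<noteq> []\<close> by (auto simp: linkable_def cycle_edges_map intro!: exI image_mono)
qed

text \<open>The right board supplies only the link edge near the right side; the other three come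
  from the left board, where they keep their position.\<close>

lemma linkable_add:
  assumes "linkable w h" and "linkable w' h" and "0 \<le> w" and "0 \<le> w'"
  shows "linkable (w + w') h"
proof -
  obtain xs where xs: "cycle_on leap (rect w h) xs" "link_edges w h \<subseteq> cycle_edges xs"
    using assms(1) by (auto simp: linkable_def)
  obtain ys where ys: "cycle_on leap (rect w' h) ys" "link_edges w' h \<subseteq> cycle_edges ys"
    using assms(2) by (auto simp: linkable_def)
  define f where "f = (\<lambda>(x, y). (x + w, y) :: int \<times> int)"
  have "ys \<noteq> []" using ys(1) by (auto simp: cycle_on_def)
  have shifted: "cycle_on leap (f ` rect w' h) (map f ys)"
    using ys(1) by (rule cycle_on_map) (auto simp: f_def inj_on_def)
  have "(x, y) \<in> f ` rect w' h \<longleftrightarrow> w \<le> x \<and> x < w + w' \<and> 0 \<le> y \<and> y < h" for x y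
  proof -
    have "(x, y) \<in> f ` rect w' h \<longleftrightarrow> (x - w, y) \<in> rect w' h"
      by (auto simp: f_def intro: image_eqI[of _ _ "(x - w, y)"])
    then show ?thesis by (auto simp: rect_def)
  qed
  then have "f ` rect w' h = {w..<w + w'} \<times> {0..<h}"
    by (simp add: set_eq_iff)
  then have rect_add: "rect w h \<union> f ` rect w' h = rect (w + w') h"
    and disj: "rect w h \<inter> f ` rect w' h = {}"
    using assms(3,4) by (auto simp: rect_def)
  have "{(0, 0), (2, 5)} \<in> cycle_edges ys" "{(w' - 5, 2), (w' - 3, 7)} \<in> cycle_edges ys"
    using ys(2) by (auto simp: link_edges_def)
  then have "f ` {(0, 0), (2, 5)} \<in> cycle_edges (map f ys)"
    "f ` {(w' - 5, 2), (w' - 3, 7)} \<in> cycle_edges (map f ys)"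
    unfolding cycle_edges_map[OF \<open>ys \<noteq> []\<close>] by (blast intro: imageI)+
  then have ys': "{(w, 0), (w + 2, 5)} \<in> cycle_edges (map f ys)"
    "{(w + w' - 5, 2), (w + w' - 3, 7)} \<in> cycle_edges (map f ys)"
    by (simp_all add: f_def algebra_simps)
  have xs': "{(w - 5, 2), (w - 3, 7)} \<in> cycle_edges xs"
    using xs(2) by (auto simp: link_edges_def)
  obtain zs where zs: "cycle_on leap (rect (w + w') h) zs"
    "(cycle_edges xs - {{(w - 5, 2), (w - 3, 7)}}) \<union>
       (cycle_edges (map f ys) - {{(w, 0), (w + 2, 5)}}) \<subseteq> cycle_edges zs"
    using merge_cycles[OF xs(1) shifted disj xs' ys'(1)] unfolding rect_add by auto
  have left: "e \<in> cycle_edges zs" if "e \<in> link_edges w h" "e \<noteq> {(w - 5, 2), (w - 3, 7)}" for e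
    using that xs(2) zs(2) by auto
  \<comment> \<open>The second coordinates alone distinguish these edges from the removed one, for
    all \<open>w\<close> and \<open>h\<close>.\<close>
  have "{(0, 0), (2, 5)} \<in> cycle_edges zs" "{(0, 0), (5, 2)} \<in> cycle_edges zs"
    "{(2, h - 5), (7, h - 3)} \<in> cycle_edges zs"
    by (rule left; simp add: link_edges_def doubleton_eq_iff)+
  moreover have right: "e \<in> cycle_edges zs"
    if "e \<in> cycle_edges (map f ys)" "e \<noteq> {(w, 0), (w + 2, 5)}" for e
    using that zs(2) by auto
  have "{(w + w' - 5, 2), (w + w' - 3, 7)} \<in> cycle_edges zs"
    by (rule right[OF ys'(2)]) (simp add: doubleton_eq_iff)
  ultimately have "link_edges (w + w') h \<subseteq> cycle_edges zs"
    by (simp add: link_edges_def)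
  with zs(1) show ?thesis by (auto simp: linkable_def)
qed

text \<open>Boards are added one at a time. The induction starts from a single board because the
  empty board has no cycle.\<close>

lemma linkable_combination:
  assumes "linkable a h" and "linkable b h" and "0 \<le> a" and "0 \<le> b" and "0 < i + j"
  shows "linkable (a * int i + b * int j) h"
  using assms(5)
proof (induction "i + j" arbitrary: i j rule: less_induct)
  case less
  consider "i = 1" "j = 0" | "i = 0" "j = 1" | i' where "i = Suc i'" "0 < i' + j"
    | j' where "j = Suc j'" "0 < i + j'"
    using less.prems by (cases i; cases j) auto
  then show ?case
  proof cases
    case 3
    then have "linkable (a * int i' + b * int j) h" using less.hyps by simp
    from linkable_add[OF assms(1) this] assms(3,4) 3 show ?thesis by (simp add: algebra_simps)
  next
    case 4
    then have "linkable (a * int i + b * int j') h" using less.hyps by simp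
    from linkable_add[OF assms(2) this] assms(3,4) 4 show ?thesis by (simp add: algebra_simps)
  qed (use assms in simp_all)
qed

section \<open>Passing from leaps to the knight's graph\<close>

lemma knights_tour_if_linkable:
  assumes "linkable (int n) (int n)"
  shows "\<exists>p. knights_tour 2 5 n p"
proof -
  obtain xs where xs: "cycle_on leap (rect (int n) (int n)) xs"
    using assms by (auto simp: linkable_def)
  have arcs: "(u, v) \<in> parcs (knights_graph 2 5 n)"
    if "u \<in> board n" "v \<in> board n" "leap u v" for u v
    using that by (cases u; cases v) (auto simp: knights_graph_def)
  \<comment> \<open>\<open>leap\<close> knows nothing of the board, whereas arcs need both ends on
    it.\<close>
  have members: "u \<in> set ys \<and> v \<in> set ys" if "{u, v} \<in> path_edges ys"
    for u v and ys :: "(int \<times> int) list"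
    using that by (induction ys rule: path_edges.induct) (auto simp: doubleton_eq_iff)
  have "xs \<noteq> []" using xs by (auto simp: cycle_on_def)
  have "(u, v) \<in> parcs (knights_graph 2 5 n)" if "{u, v} \<in> cycle_edges xs" for u v
  proof (rule arcs)
    have "set xs = board n"
      using xs by (simp add: cycle_on_def rect_def board_def)
    then have "set (xs @ [hd xs]) = board n"
      using hd_in_set[OF \<open>xs \<noteq> []\<close>] by (simp add: insert_absorb)
    with that members[of u v "xs @ [hd xs]"] show "u \<in> board n" "v \<in> board n"
      by (simp_all only: cycle_edges_def)
    show "leap u v" using xs that unfolding cycle_on_def by blast
  qed
  then have "cycle_on (\<lambda>u v. (u, v) \<in> parcs (knights_graph 2 5 n)) (board n) xs"
    using xs by (simp add: cycle_on_def rect_def board_def)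
  then have "\<exists>p. hamiltonian_cycle (knights_graph 2 5 n) p"
    by (intro hamiltonian_cycle_of_cycle_on) (simp add: knights_graph_def)
  then show ?thesis by (simp add: knights_tour_def)
qed

section \<open>Tours of the small boards\<close>

text \<open>A form that the simplifier can evaluate on a concrete list: a count replaces equality
  with the board, and link edges are sought only among consecutive entries, not at the closing
  edge.\<close>

definition linkable_tour :: "int \<Rightarrow> int \<Rightarrow> (int \<times> int) list \<Rightarrow> bool" where
  "linkable_tour w h xs \<longleftrightarrow>
     distinct xs \<and> int (length xs) = w * h \<and> 3 \<le> length xs \<and>
     list_all (\<lambda>(x, y). 0 \<le> x \<and> x < w \<and> 0 \<le> y \<and> y < h) xs \<and>
     successively leap (xs @ [hd xs]) \<and>
     list_all (\<lambda>(u, v). list_ex (\<lambda>e. e = (u, v) \<or> e = (v, u)) (zip xs (tl xs)))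
       [((0, 0), (2, 5)), ((w - 5, 2), (w - 3, 7)), ((0, 0), (5, 2)), ((2, h - 5), (7, h - 3))]"

text \<open>Distinct squares of the board, as many as it has, fill it.\<close>

lemma linkable_if_linkable_tour:
  assumes "linkable_tour w h xs" and "0 \<le> w" and "0 \<le> h"
  shows "linkable w h"
proof -
  have "distinct xs" "int (length xs) = w * h" "3 \<le> length xs"
    using assms(1) by (auto simp: linkable_tour_def)
  have "set xs \<subseteq> rect w h"
    using assms(1) by (auto simp: linkable_tour_def list_all_iff rect_def)
  moreover have "card (set xs) = card (rect w h)"
    using \<open>distinct xs\<close> \<open>int (length xs) = w * h\<close> assms(2,3)
    by (simp add: rect_def distinct_card nat_mult_distrib[symmetric])
  ultimately have "set xs = rect w h"
    by (intro card_subset_eq) (auto simp: rect_def)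
  \<comment> \<open>\<open>successively\<close> gives the leaps in list order only; symmetry of
    \<open>leap\<close> gives the other direction.\<close>
  have leap: "leap u v" if "successively leap ys" "{u, v} \<in> path_edges ys" for ys u v
    using that by (induction ys rule: path_edges.induct) (auto simp: doubleton_eq_iff leap_commute)
  have "successively leap (xs @ [hd xs])" using assms(1) by (simp add: linkable_tour_def)
  then have "cycle_on leap (rect w h) xs"
    using \<open>distinct xs\<close> \<open>set xs = rect w h\<close> \<open>3 \<le> length xs\<close> leap[of "xs @ [hd xs]"]
    by (simp add: cycle_on_def cycle_edges_def)
  moreover have edge: "{u, v} \<in> cycle_edges xs"
    if "list_ex (\<lambda>e. e = (u, v) \<or> e = (v, u)) (zip xs (tl xs))" for u v
  proof -
    from that have "{u, v} \<in> path_edges xs"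
      by (auto simp: list_ex_iff insert_commute dest: zip_tl_path_edges)
    with \<open>3 \<le> length xs\<close> show ?thesis by (subst cycle_edges_eq) auto
  qed
  have "link_edges w h \<subseteq> cycle_edges xs"
    using assms(1) edge unfolding linkable_tour_def link_edges_def list.pred_inject prod.case
    by blast
  ultimately show ?thesis by (auto simp: linkable_def)
qed

text \<open>Each of the three lists starts one square before the corner, which keeps both link edges
  at \<open>(0, 0)\<close> away from the closing edge.\<close>

definition tour_14_14 :: "(int \<times> int) list" where
  "tour_14_14 =
   [(2,5), (0,0), (5,2), (0,4), (5,6), (3,1), (1,6), (3,11), (8,13), (13,11), (8,9), (10,4),
    (12,9), (7,7), (9,12), (4,10), (6,5), (4,0), (9,2), (11,7), (13,12), (8,10), (3,12), (1,7),
    (6,9), (8,4), (13,2), (8,0), (3,2), (5,7), (0,9), (2,4), (7,6), (9,11), (4,13), (6,8), (1,10),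
    (6,12), (11,10), (13,5), (11,0), (9,5), (4,3), (9,1), (11,6), (13,1), (8,3), (10,8), (12,13),
    (7,11), (2,9), (4,4), (9,6), (11,11), (13,6), (11,1), (6,3), (1,1), (3,6), (1,11), (6,13),
    (4,8), (2,13), (0,8), (2,3), (7,1), (12,3), (7,5), (9,10), (4,12), (6,7), (4,2), (9,0), (11,5),
    (13,0), (8,2), (3,0), (1,5), (3,10), (8,12), (13,10), (8,8), (10,13), (12,8), (7,10), (12,12),
    (10,7), (12,2), (7,0), (5,5), (10,3), (5,1), (0,3), (2,8), (0,13), (5,11), (10,9), (12,4),
    (7,2), (12,0), (10,5), (12,10), (7,12), (9,7), (4,9), (6,4), (1,2), (3,7), (1,12), (6,10),
    (11,12), (13,7), (11,2), (6,0), (4,5), (2,0), (0,5), (2,10), (7,8), (9,13), (4,11), (6,6),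
    (1,4), (6,2), (1,0), (3,5), (5,10), (0,12), (2,7), (0,2), (5,0), (10,2), (12,7), (10,12),
    (8,7), (13,9), (11,4), (9,9), (4,7), (2,12), (0,7), (2,2), (7,4), (5,9), (0,11), (5,13),
    (10,11), (12,6), (10,1), (5,3), (0,1), (2,6), (4,1), (9,3), (11,8), (13,13), (8,11), (3,9),
    (5,4), (0,6), (2,1), (7,3), (12,1), (10,6), (12,11), (7,9), (9,4), (11,9), (13,4), (8,6),
    (3,4), (1,9), (6,11), (1,13), (3,8), (1,3), (6,1), (11,3), (13,8), (11,13), (9,8), (4,6),
    (2,11), (7,13), (5,8), (3,13), (1,8), (3,3), (8,1), (13,3), (8,5), (10,0), (12,5), (10,10),
    (5,12), (0,10)]"

definition tour_14_18 :: "(int \<times> int) list" where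
  "tour_14_18 =
   [(2,5), (0,0), (5,2), (0,4), (2,9), (4,14), (9,16), (7,11), (12,13), (10,8), (12,3), (7,1),
    (2,3), (0,8), (5,6), (10,4), (12,9), (10,14), (5,16), (0,14), (5,12), (3,17), (1,12), (3,7),
    (1,2), (6,0), (11,2), (13,7), (8,9), (6,4), (1,6), (3,1), (8,3), (13,1), (11,6), (13,11),
    (11,16), (9,11), (4,13), (6,8), (1,10), (3,15), (8,17), (6,12), (4,7), (9,5), (11,0), (13,5),
    (11,10), (13,15), (8,13), (3,11), (1,16), (6,14), (11,12), (13,17), (8,15), (10,10), (12,15),
    (7,17), (2,15), (4,10), (6,15), (1,17), (3,12), (1,7), (3,2), (8,0), (13,2), (11,7), (9,2),
    (4,0), (6,5), (11,3), (6,1), (1,3), (3,8), (1,13), (6,11), (11,13), (13,8), (8,10), (13,12),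
    (11,17), (9,12), (7,7), (12,5), (10,0), (8,5), (3,3), (8,1), (13,3), (11,8), (13,13), (8,11),
    (3,13), (1,8), (6,10), (4,5), (2,0), (0,5), (5,7), (10,5), (12,0), (7,2), (9,7), (4,9), (2,4),
    (0,9), (2,14), (7,16), (12,14), (10,9), (12,4), (7,6), (9,1), (4,3), (2,8), (0,3), (5,1),
    (10,3), (12,8), (7,10), (9,15), (4,17), (2,12), (0,17), (5,15), (0,13), (5,11), (10,13), (8,8),
    (13,10), (11,15), (6,13), (11,11), (13,16), (8,14), (3,16), (1,11), (6,9), (4,4), (9,6),
    (11,1), (13,6), (8,4), (3,6), (1,1), (6,3), (1,5), (3,10), (1,15), (6,17), (8,12), (10,17),
    (12,12), (10,7), (5,9), (3,4), (8,6), (13,4), (11,9), (13,14), (8,16), (3,14), (1,9), (6,7),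
    (4,12), (2,17), (0,12), (5,10), (7,5), (9,0), (4,2), (2,7), (0,2), (5,0), (3,5), (1,0), (6,2),
    (1,4), (6,6), (11,4), (9,9), (7,14), (12,16), (10,11), (5,13), (0,11), (2,16), (4,11), (9,13),
    (4,15), (9,17), (7,12), (2,10), (0,15), (5,17), (10,15), (12,10), (7,8), (9,3), (4,1), (2,6),
    (0,1), (5,3), (10,1), (12,6), (7,4), (12,2), (7,0), (2,2), (0,7), (5,5), (3,0), (8,2), (13,0),
    (11,5), (9,10), (4,8), (2,13), (7,15), (12,17), (10,12), (12,7), (10,2), (8,7), (13,9),
    (11,14), (6,16), (1,14), (3,9), (5,4), (0,6), (2,1), (7,3), (12,1), (10,6), (12,11), (10,16),
    (5,14), (0,16), (2,11), (4,16), (9,14), (7,9), (9,4), (4,6), (9,8), (7,13), (5,8), (0,10)]"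

definition tour_18_18 :: "(int \<times> int) list" where
  "tour_18_18 =
   [(2,5), (0,0), (5,2), (10,4), (15,6), (17,1), (12,3), (7,1), (2,3), (4,8), (9,10), (4,12),
    (6,17), (1,15), (3,10), (1,5), (3,0), (8,2), (13,0), (15,5), (17,0), (12,2), (17,4), (12,6),
    (7,4), (2,2), (7,0), (9,5), (4,7), (6,12), (4,17), (2,12), (0,17), (5,15), (10,13), (15,15),
    (17,10), (12,12), (10,17), (8,12), (10,7), (5,9), (0,7), (5,5), (7,10), (12,8), (14,3), (16,8),
    (14,13), (9,15), (14,17), (16,12), (14,7), (9,9), (7,14), (2,16), (0,11), (5,13), (10,15),
    (15,17), (17,12), (12,10), (14,15), (16,10), (14,5), (16,0), (11,2), (16,4), (14,9), (16,14),
    (11,16), (6,14), (1,16), (3,11), (5,16), (0,14), (2,9), (0,4), (5,6), (7,11), (9,6), (14,4),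
    (16,9), (14,14), (9,16), (4,14), (9,12), (11,17), (16,15), (14,10), (16,5), (14,0), (12,5),
    (17,3), (12,1), (10,6), (5,4), (0,6), (5,8), (0,10), (5,12), (10,14), (15,16), (17,11),
    (12,13), (10,8), (5,10), (0,8), (2,13), (7,15), (2,17), (0,12), (2,7), (0,2), (5,0), (7,5),
    (9,0), (4,2), (6,7), (11,9), (13,14), (8,16), (3,14), (1,9), (3,4), (8,6), (13,4), (15,9),
    (17,14), (12,16), (10,11), (15,13), (17,8), (15,3), (10,1), (5,3), (0,1), (2,6), (4,1), (6,6),
    (11,4), (16,2), (11,0), (13,5), (11,10), (13,15), (8,17), (10,12), (8,7), (13,9), (11,14),
    (16,16), (14,11), (16,6), (14,1), (9,3), (7,8), (9,13), (4,11), (6,16), (1,14), (3,9), (1,4),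
    (6,2), (1,0), (3,5), (1,10), (3,15), (8,13), (13,11), (11,6), (13,1), (8,3), (3,1), (1,6),
    (6,4), (1,2), (6,0), (4,5), (2,0), (0,5), (2,10), (0,15), (5,17), (7,12), (9,17), (4,15),
    (6,10), (1,8), (3,3), (8,1), (13,3), (11,8), (13,13), (8,11), (3,13), (8,15), (3,17), (1,12),
    (3,7), (8,9), (13,7), (11,12), (13,17), (15,12), (17,17), (12,15), (7,17), (2,15), (7,13),
    (2,11), (0,16), (5,14), (10,16), (15,14), (17,9), (15,4), (10,2), (15,0), (17,5), (15,10),
    (17,15), (12,17), (14,12), (16,17), (11,15), (6,13), (1,11), (3,16), (8,14), (13,16), (15,11),
    (17,16), (12,14), (10,9), (5,11), (0,13), (2,8), (0,3), (5,1), (10,3), (15,1), (17,6), (12,4),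
    (17,2), (12,0), (7,2), (9,7), (4,9), (2,14), (7,16), (9,11), (4,13), (6,8), (4,3), (9,1),
    (7,6), (2,4), (0,9), (5,7), (3,2), (1,7), (3,12), (1,17), (6,15), (4,10), (9,8), (7,3), (2,1),
    (4,6), (9,4), (7,9), (12,7), (14,2), (16,7), (11,5), (13,10), (8,8), (13,6), (11,11), (16,13),
    (14,8), (16,3), (11,1), (6,3), (1,1), (3,6), (8,4), (6,9), (4,4), (9,2), (4,0), (6,5), (8,0),
    (10,5), (15,7), (13,2), (11,7), (13,12), (8,10), (13,8), (11,13), (16,11), (14,16), (9,14),
    (4,16), (6,11), (1,13), (3,8), (1,3), (6,1), (11,3), (16,1), (14,6), (12,11), (17,13), (15,8),
    (10,10), (8,5), (10,0), (15,2), (17,7), (12,9), (7,7)]"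

lemma linkable_14_14: "linkable 14 14"
proof (rule linkable_if_linkable_tour)
  show "linkable_tour 14 14 tour_14_14"
    unfolding linkable_tour_def by (intro conjI) (simp_all add: tour_14_14_def)
qed simp_all

lemma linkable_14_18: "linkable 14 18"
proof (rule linkable_if_linkable_tour)
  show "linkable_tour 14 18 tour_14_18"
    unfolding linkable_tour_def by (intro conjI) (simp_all add: tour_14_18_def)
qed simp_all

lemma linkable_18_18: "linkable 18 18"
proof (rule linkable_if_linkable_tour)
  show "linkable_tour 18 18 tour_18_18"
    unfolding linkable_tour_def by (intro conjI) (simp_all add: tour_18_18_def)
qed simp_all

section \<open>Assembling large even boards\<close>

theorem theorem19:
  shows "\<exists>n\<^sub>0 :: nat. \<forall>n \<ge> n\<^sub>0. even n \<longrightarrow> (\<exists>p. knights_tour 2 5 n p)"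
proof (rule exI[of _ 108], intro allI impI)
  fix n :: nat
  assume "108 \<le> n" "even n"
  then obtain m where m: "n = 2 * m" "54 \<le> m" by auto
  \<comment> \<open>To solve \<open>7 * i + 9 * j = m\<close>, note that \<open>j\<close> must be
    \<open>4 * m\<close> modulo 7; taking the least such \<open>j\<close> gives this
    \<open>i\<close>. As \<open>j\<close> is at most 6, \<open>54 \<le> m\<close> ensures that the
    subtraction in \<open>i\<close> does not truncate, whence the bound 108.\<close>
  define j where "j = 4 * m mod 7"
  define i where "i = 9 * (4 * m div 7) - 5 * m"
  have "4 * m = 7 * (4 * m div 7) + j" "j < 7" by (simp_all add: j_def)
  then have n: "int n = 14 * int i + 18 * int j" and "0 < i + j"
    using m unfolding i_def by linarith+
  have row: "linkable (int n) h" if "linkable 14 h" "linkable 18 h" for h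
    unfolding n using that \<open>0 < i + j\<close> by (intro linkable_combination) simp_all
  \<comment> \<open>First come strips of width \<open>n\<close> and heights 14 and 18; their
    transposes, set side by side, then form the square.\<close>
  have "linkable (int n) 14" "linkable (int n) 18"
    using linkable_14_14 linkable_14_18 linkable_18_18 by (auto intro: row linkable_commute)
  then have "linkable (int n) (int n)" by (blast intro: row linkable_commute)
  then show "\<exists>p. knights_tour 2 5 n p" by (rule knights_tour_if_linkable)
qed

end
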